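(* Let $J:\Omega\to(0,1)$ be a Hölder Jacobian, and let $\mu_1,\mu_2$ be suitable probabilities on $\Omega$ with continuous IRNs $J_1$ and $J_2$ respectively. Then $$D_{KL}(\mu_1,\mu_2)-D_{KL}\big(\mathcal{L}_{\log J}^*(\mu_1),\mathcal{L}_{\log J}^*(\mu_2)\big)=0.$$
   Context: Let $d\ge 2$, $\Omega=\{1,\dots,d\}^{\mathbb N}$ with metric $d(x,y)=2^{-N}$, where $N$ is the smallest $j$ with $x_j\ne y_j$ (and $d(x,x)=0$), and let $\sigma:\Omega\to\Omega$ be the shift $\sigma(x_1,x_2,\dots)=(x_2,x_3,\dots)$. For $a\in\{1,\dots,d\}$ and $x\in\Omega$ write $ax=(a,x_1,x_2,\dots)$, and let $\overline a=\{ax: x\in\Omega\}$. IRN and suitable probabilities: a Borel probability $\mu$ on $\Omega$ (not necessarily $\sigma$-invariant) is called suitable if there is a continuous, strictly positive function $J_\mu:\Omega\to\mathbb R$ such that $\mu(\sigma(B))=\int_B J_\mu^{-1}\,d\mu$ for every $j\in\{1,\dots,d\}$ and every Borel set $B\subset\overline j$; equivalently, for every $j$ and every continuous $\varphi$ vanishing outside $\overline j$, $\int\varphi(jx)J_\mu(jx)\,d\mu(x)=\int\varphi\,d\mu$. The function $J_\mu$ is called the IRN (inverse Radon-Nikodym derivative in injective branches) of $\mu$; a suitable probability has full support, so $J_\mu$ is unique. Jacobian: a continuous positive function $J:\Omega\to(0,1)$ with $\sum_{a=1}^d J(ax)=1$ for all $x\in\Omega$. Ruelle operator: $\mathcal L_{\log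 J}(\varphi)(x)=\sum_{a=1}^d J(ax)\varphi(ax)$ for continuous $\varphi:\Omega\to\mathbb{R}$. Its dual acts on probabilities by $\int\varphi\,d\mathcal L_{\log J}^*(\rho)=\int\mathcal L_{\log J}(\varphi)\,d\rho$ for all continuous $\varphi$. If $\mu$ is suitable and $J$ is a continuous Jacobian, then $\mathcal L_{\log J}^*(\mu)$ is again suitable. KL divergence: for suitable probabilities $\nu_1,\nu_2$ with IRNs $J_{\nu_1},J_{\nu_2}$, $D_{KL}(\nu_1,\nu_2)=-\int\log J_{\nu_2}\,d\nu_1+\int\log J_{\nu_1}\,d\nu_1$. *)

theory Defs
  imports "HOL-Probability.Probability"
begin

text \<open>
  Sequences are indexed from 0, so the mathematical coordinate \<open>x\<^sub>j\<close> (with \<open>j \<ge> 1\<close>) is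
  \<open>x (j - 1)\<close>. The alphabet size \<open>d\<close> is an explicit argument; functions on \<open>Omega d\<close> are
  HOL functions on the whole type whose values outside \<open>Omega d\<close> are irrelevant.
\<close>

definition Omega :: "nat \<Rightarrow> (nat \<Rightarrow> nat) set" where
  "Omega d = {x. \<forall>n. x n \<in> {1..d}}"

text \<open>The successor accounts for the shift of indices: the exponent is at least 1.\<close>

definition seq_dist :: "(nat \<Rightarrow> nat) \<Rightarrow> (nat \<Rightarrow> nat) \<Rightarrow> real" where
  "seq_dist x y = (if x = y then 0 else (1 / 2) ^ Suc (LEAST n. x n \<noteq> y n))"

lemma Metric_space_Omega: "Metric_space (Omega d) seq_dist"
proof
  fix x y z :: "nat \<Rightarrow> nat"
  show "0 \<le> seq_dist x y"
    by (simp add: seq_dist_def)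
  show "seq_dist x y = seq_dist y x"
    by (simp add: seq_dist_def eq_commute)
  show "seq_dist x y = 0 \<longleftrightarrow> x = y"
    by (simp add: seq_dist_def)
  show "seq_dist x z \<le> seq_dist x y + seq_dist y z"
  proof (cases "x = y \<or> y = z \<or> x = z")
    case True
    then show ?thesis by (auto simp: seq_dist_def)
  next
    case False
    define k where "k = (LEAST n. x n \<noteq> z n)"
    have "x k \<noteq> z k"
      unfolding k_def by (rule LeastI_ex) (use False in auto)
    then have "x k \<noteq> y k \<or> y k \<noteq> z k" by auto
    then have "(LEAST n. x n \<noteq> y n) \<le> k \<or> (LEAST n. y n \<noteq> z n) \<le> k"
      by (auto intro: Least_le)
    then have "(1 / 2 :: real) ^ Suc k \<le> (1 / 2) ^ Suc (LEAST n. x n \<noteq> y n) \<or>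
        (1 / 2 :: real) ^ Suc k \<le> (1 / 2) ^ Suc (LEAST n. y n \<noteq> z n)"
      by (elim disjE) (rule disjI1 disjI2, rule power_decreasing; simp)+
    then have "seq_dist x z \<le> seq_dist x y \<or> seq_dist x z \<le> seq_dist y z"
      using False unfolding seq_dist_def k_def by presburger
    moreover have "0 \<le> seq_dist x y" "0 \<le> seq_dist y z"
      by (simp_all add: seq_dist_def)
    ultimately show ?thesis by linarith
  qed
qed

definition Omega_topology :: "nat \<Rightarrow> (nat \<Rightarrow> nat) topology" where
  "Omega_topology d = Metric_space.mtopology (Omega d) seq_dist"

definition continuous_Omega :: "nat \<Rightarrow> ((nat \<Rightarrow> nat) \<Rightarrow> real) \<Rightarrow> bool" where
  "continuous_Omega d f \<longleftrightarrow> continuous_map (Omega_topology d) euclideanreal f"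

definition Holder_Omega :: "nat \<Rightarrow> ((nat \<Rightarrow> nat) \<Rightarrow> real) \<Rightarrow> bool" where
  "Holder_Omega d f \<longleftrightarrow> (\<exists>C \<alpha>. 0 < \<alpha> \<and>
     (\<forall>x\<in>Omega d. \<forall>y\<in>Omega d. \<bar>f x - f y\<bar> \<le> C * seq_dist x y powr \<alpha>))"

definition Omega_borel :: "nat \<Rightarrow> (nat \<Rightarrow> nat) measure" where
  "Omega_borel d = sigma (Omega d) {U. openin (Omega_topology d) U}"

definition borel_probability :: "nat \<Rightarrow> (nat \<Rightarrow> nat) measure \<Rightarrow> bool" where
  "borel_probability d \<mu> \<longleftrightarrow> prob_space \<mu> \<and> sets \<mu> = sets (Omega_borel d)"

definition shift :: "(nat \<Rightarrow> nat) \<Rightarrow> (nat \<Rightarrow> nat)" where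
  "shift x = (\<lambda>n. x (Suc n))"

definition prepend :: "nat \<Rightarrow> (nat \<Rightarrow> nat) \<Rightarrow> (nat \<Rightarrow> nat)" where
  "prepend a x = case_nat a x"

definition cylinder :: "nat \<Rightarrow> nat \<Rightarrow> (nat \<Rightarrow> nat) set" where
  "cylinder d a = prepend a ` Omega d"

definition is_IRN :: "nat \<Rightarrow> (nat \<Rightarrow> nat) measure \<Rightarrow> ((nat \<Rightarrow> nat) \<Rightarrow> real) \<Rightarrow> bool" where
  "is_IRN d \<mu> J \<longleftrightarrow>
     continuous_Omega d J \<and> (\<forall>x\<in>Omega d. 0 < J x) \<and>
     (\<forall>j\<in>{1..d}. \<forall>B\<in>sets (Omega_borel d). B \<subseteq> cylinder d j \<longrightarrow>
        measure \<mu> (shift ` B) = (LINT x:B|\<mu>. inverse (J x)))"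

definition suitable :: "nat \<Rightarrow> (nat \<Rightarrow> nat) measure \<Rightarrow> bool" where
  "suitable d \<mu> \<longleftrightarrow> borel_probability d \<mu> \<and> (\<exists>J. is_IRN d \<mu> J)"

text \<open>
  An IRN is unique only as a function on \<open>Omega d\<close>; extensionality fixes its values elsewhere.
\<close>

definition IRN :: "nat \<Rightarrow> (nat \<Rightarrow> nat) measure \<Rightarrow> (nat \<Rightarrow> nat) \<Rightarrow> real" where
  "IRN d \<mu> = (THE J. J \<in> extensional (Omega d) \<and> is_IRN d \<mu> J)"

definition Jacobian :: "nat \<Rightarrow> ((nat \<Rightarrow> nat) \<Rightarrow> real) \<Rightarrow> bool" where
  "Jacobian d J \<longleftrightarrow>
     continuous_Omega d J \<and> (\<forall>x\<in>Omega d. J x \<in> {0<..<1}) \<and>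
     (\<forall>x\<in>Omega d. (\<Sum>a=1..d. J (prepend a x)) = 1)"

definition ruelle ::
    "nat \<Rightarrow> ((nat \<Rightarrow> nat) \<Rightarrow> real) \<Rightarrow> ((nat \<Rightarrow> nat) \<Rightarrow> real) \<Rightarrow> (nat \<Rightarrow> nat) \<Rightarrow> real" where
  "ruelle d J \<phi> x = (\<Sum>a=1..d. J (prepend a x) * \<phi> (prepend a x))"

definition ruelle_dual ::
    "nat \<Rightarrow> ((nat \<Rightarrow> nat) \<Rightarrow> real) \<Rightarrow> (nat \<Rightarrow> nat) measure \<Rightarrow> (nat \<Rightarrow> nat) measure" where
  "ruelle_dual d J \<rho> = (THE \<nu>. borel_probability d \<nu> \<and>
     (\<forall>\<phi>. continuous_Omega d \<phi> \<longrightarrow> (LINT x|\<nu>. \<phi> x) = (LINT x|\<rho>. ruelle d J \<phi> x)))"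

definition D_KL :: "nat \<Rightarrow> (nat \<Rightarrow> nat) measure \<Rightarrow> (nat \<Rightarrow> nat) measure \<Rightarrow> real" where
  "D_KL d \<nu>\<^sub>1 \<nu>\<^sub>2 = - (LINT x|\<nu>\<^sub>1. ln (IRN d \<nu>\<^sub>2 x)) + (LINT x|\<nu>\<^sub>1. ln (IRN d \<nu>\<^sub>1 x))"

end

theory Submission
  imports Defs
begin

text \<open>
  Let \<open>\<mu>\<close> be suitable with IRN \<open>K\<close>. The IRN identity says that the image of \<open>\<mu>\<close> under the inverse
  branch \<open>prepend a\<close> has density \<open>1 / K\<close> with respect to \<open>\<mu>\<close> on the branch's cylinder
  (\<open>distr_prepend\<close>). Weighting the branches by \<open>J\<close> and adding them up, the dual Ruelle operator
  merely multiplies \<open>\<mu>\<close> by the density \<open>J / K\<close> (\<open>ruelle_dual_eq_density\<close>). A change of density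
  changes an IRN by a cocycle, so the IRN of the image is \<open>K (shift x) * J x / J (shift x)\<close>
  (\<open>is_IRN_ruelle_dual\<close>).

  When the logarithms of two such IRNs, for the same \<open>J\<close>, are subtracted, the factors that contain
  \<open>J\<close> cancel. What remains is \<open>ln J\<^sub>1 - ln J\<^sub>2\<close> composed with the shift. Because
  \<open>ruelle d J (g \<circ> shift) = g\<close> for a Jacobian, the integral of \<open>g \<circ> shift\<close> against the image of
  \<open>\<mu>\<^sub>1\<close> is the integral of \<open>g\<close> against \<open>\<mu>\<^sub>1\<close> (\<open>integral_ruelle_dual_shift\<close>), and the two
  divergences agree.

  Around this computation, three facts make the definitions mean what they should. The sequence
  space is compact, so all continuous functions involved, the logarithms of IRNs in particular, are
  integrable. Word cylinders are clopen and generate the Borel sets, so a Borel probability is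
  determined by its integrals of continuous functions, and the description defining the dual
  operator is unique. Suitable probabilities charge every cylinder, so an IRN is unique.
\<close>

section \<open>Topology of the sequence space\<close>

definition word_cylinder :: "nat \<Rightarrow> nat list \<Rightarrow> (nat \<Rightarrow> nat) set" where
  "word_cylinder d w = {y \<in> Omega d. \<forall>i<length w. y i = w ! i}"

lemma word_cylinder_subset_Omega: "word_cylinder d w \<subseteq> Omega d"
  by (auto simp: word_cylinder_def)

lemma mem_word_cylinder_prefix:
  "y \<in> word_cylinder d (map x [0..<n]) \<longleftrightarrow> y \<in> Omega d \<and> (\<forall>i<n. y i = x i)"
  by (auto simp: word_cylinder_def)

lemma seq_dist_less_iff: "seq_dist x y < (1 / 2) ^ n \<longleftrightarrow> (\<forall>i<n. x i = y i)"
proof (cases "x = y")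
  case True
  then show ?thesis by (simp add: seq_dist_def)
next
  case False
  define k where "k = (LEAST i. x i \<noteq> y i)"
  have k: "x k \<noteq> y k"
    unfolding k_def by (rule LeastI_ex) (use False in auto)
  have least: "i < k \<Longrightarrow> x i = y i" for i
    unfolding k_def using not_less_Least by blast
  have "seq_dist x y < (1 / 2) ^ n \<longleftrightarrow> (1 / 2 :: real) ^ Suc k < (1 / 2) ^ n"
    using False by (simp add: seq_dist_def k_def)
  also have "\<dots> \<longleftrightarrow> n < Suc k"
    by (rule power_strict_decreasing_iff) auto
  also have "\<dots> \<longleftrightarrow> (\<forall>i<n. x i = y i)"
    using k least by (metis less_Suc_eq_le not_less order_less_le_trans)
  finally show ?thesis .
qed

lemma topspace_Omega [simp]: "topspace (Omega_topology d) = Omega d"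
  unfolding Omega_topology_def
  by (rule Metric_space.topspace_mtopology[OF Metric_space_Omega])

lemma openin_Omega_iff:
  "openin (Omega_topology d) U \<longleftrightarrow>
     U \<subseteq> Omega d \<and> (\<forall>x\<in>U. \<exists>n. word_cylinder d (map x [0..<n]) \<subseteq> U)"
proof -
  interpret Metric_space "Omega d" seq_dist by (rule Metric_space_Omega)
  have ball: "mball x ((1 / 2) ^ n) = word_cylinder d (map x [0..<n])" if "x \<in> Omega d" for x n
    using that by (auto simp: mball_def seq_dist_less_iff mem_word_cylinder_prefix)
  have "(\<exists>r>0. mball x r \<subseteq> U) \<longleftrightarrow> (\<exists>n. word_cylinder d (map x [0..<n]) \<subseteq> U)"
    if x: "x \<in> Omega d" for x
  proof
    assume "\<exists>r>0. mball x r \<subseteq> U"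
    then obtain r where r: "r > 0" "mball x r \<subseteq> U" by blast
    then obtain n where "(1 / 2 :: real) ^ n < r"
      using real_arch_pow_inv[of r "1 / 2"] by auto
    then have "mball x ((1 / 2) ^ n) \<subseteq> mball x r"
      by (intro mball_subset_concentric) simp
    then show "\<exists>n. word_cylinder d (map x [0..<n]) \<subseteq> U"
      using r ball[OF x] by blast
  next
    assume "\<exists>n. word_cylinder d (map x [0..<n]) \<subseteq> U"
    then obtain n where "mball x ((1 / 2) ^ n) \<subseteq> U"
      using ball[OF x] by auto
    then show "\<exists>r>0. mball x r \<subseteq> U"
      by (intro exI[of _ "(1 / 2) ^ n"]) simp
  qed
  then show ?thesis
    unfolding Omega_topology_def openin_mtopology by (meson subsetD)
qed

lemma openin_subset_Omega: "openin (Omega_topology d) U \<Longrightarrow> U \<subseteq> Omega d"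
  by (simp add: openin_Omega_iff)

lemma openin_word_cylinder: "openin (Omega_topology d) (word_cylinder d w)"
  unfolding openin_Omega_iff
proof (intro conjI word_cylinder_subset_Omega ballI)
  fix x assume "x \<in> word_cylinder d w"
  then have "word_cylinder d (map x [0..<length w]) \<subseteq> word_cylinder d w"
    by (auto simp: word_cylinder_def)
  then show "\<exists>n. word_cylinder d (map x [0..<n]) \<subseteq> word_cylinder d w" by blast
qed

text \<open>By Tychonoff's theorem the product topology on the same points is compact. Each word cylinder
  constrains finitely many coordinates, hence is open in the product, so the identity from the
  product onto the metric space is continuous and carries compactness over.\<close>

lemma compact_space_Omega: "compact_space (Omega_topology d)"
proof -
  let ?P = "product_topology (\<lambda>_::nat. discrete_topology {1..d}) UNIV"
  have top: "topspace ?P = Omega d"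
    by (auto simp: Omega_def PiE_def Pi_def)
  have "continuous_map ?P (Omega_topology d) id"
    unfolding continuous_map_def
  proof (intro conjI allI impI)
    fix U assume U: "openin (Omega_topology d) U"
    have "openin ?P U"
      unfolding openin_product_topology_alt
    proof (intro ballI)
      fix x assume x: "x \<in> U"
      obtain n where n: "word_cylinder d (map x [0..<n]) \<subseteq> U"
        using U x unfolding openin_Omega_iff by blast
      have xO: "x i \<in> {1..d}" for i
        using U x unfolding openin_Omega_iff Omega_def by blast
      define V where "V i = (if i < n then {x i} else {1..d})" for i
      have "finite {i. V i \<noteq> {1..d}}"
        by (rule finite_subset[of _ "{..<n}"]) (auto simp: V_def)
      moreover have "V i \<subseteq> {1..d}" for i
        using xO by (auto simp: V_def)
      moreover have "x \<in> PiE UNIV V"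
        using xO by (auto simp: V_def)
      moreover have "PiE UNIV V \<subseteq> word_cylinder d (map x [0..<n])"
      proof
        fix y assume y: "y \<in> PiE UNIV V"
        have "y i \<in> {1..d}" for i
          using y \<open>V i \<subseteq> {1..d}\<close> by blast
        moreover have "y i = x i" if "i < n" for i
        proof -
          have "y i \<in> V i" using y by blast
          then show ?thesis using that by (simp add: V_def)
        qed
        ultimately show "y \<in> word_cylinder d (map x [0..<n])"
          by (simp add: mem_word_cylinder_prefix Omega_def)
      qed
      ultimately show "\<exists>V. finite {i \<in> UNIV. V i \<noteq> topspace (discrete_topology {1..d})} \<and>
            (\<forall>i\<in>UNIV. openin (discrete_topology {1..d}) (V i)) \<and>
            x \<in> Pi\<^sub>E UNIV V \<and> Pi\<^sub>E UNIV V \<subseteq> U"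
        using n by (intro exI[of _ V]) auto
    qed
    moreover have "{x \<in> topspace ?P. id x \<in> U} = U"
      using openin_subset[OF U] unfolding top by auto
    ultimately show "openin ?P {x \<in> topspace ?P. id x \<in> U}" by simp
  qed (use top in auto)
  moreover have "compactin ?P (Omega d)"
  proof -
    have "compact_space ?P"
      unfolding compact_space_product_topology by (simp add: compact_space_discrete_topology)
    then show ?thesis unfolding compact_space_def top .
  qed
  ultimately have "compactin (Omega_topology d) (id ` Omega d)"
    by (rule image_compactin[rotated])
  then show ?thesis by (simp add: compact_space_def)
qed

lemma continuous_Omega_bounded:
  assumes "continuous_Omega d f"
  shows "\<exists>B. \<forall>x\<in>Omega d. \<bar>f x\<bar> \<le> B"
proof -
  have "compactin euclideanreal (f ` Omega d)"
    using image_compactin[OF _ assms[unfolded continuous_Omega_def]] compact_space_Omega[of d]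
    by (simp add: compact_space_def)
  then have "bounded (f ` Omega d)"
    by (simp add: compact_imp_bounded)
  then show ?thesis by (auto simp: bounded_iff)
qed

lemma shift_in_Omega: "x \<in> Omega d \<Longrightarrow> shift x \<in> Omega d"
  by (simp add: Omega_def shift_def)

lemma prepend_in_Omega: "a \<in> {1..d} \<Longrightarrow> x \<in> Omega d \<Longrightarrow> prepend a x \<in> Omega d"
  by (auto simp: Omega_def prepend_def split: nat.split)

lemma shift_prepend [simp]: "shift (prepend a x) = x"
  by (simp add: shift_def prepend_def)

lemma prepend_shift [simp]: "prepend (x 0) (shift x) = x"
  by (auto simp: shift_def prepend_def fun_eq_iff split: nat.split)

lemma prepend_0 [simp]: "prepend a x 0 = a"
  by (simp add: prepend_def)

lemma cylinder_eq: "a \<in> {1..d} \<Longrightarrow> cylinder d a = {x \<in> Omega d. x 0 = a}"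
  unfolding cylinder_def
proof (intro equalityI subsetI)
  fix x assume "a \<in> {1..d}" "x \<in> {x \<in> Omega d. x 0 = a}"
  then have "x = prepend a (shift x)" "shift x \<in> Omega d"
    using prepend_shift[of x] by (auto intro: shift_in_Omega)
  then show "x \<in> prepend a ` Omega d" by blast
qed (auto intro: prepend_in_Omega)

lemma word_cylinder_Cons_subset:
  assumes "a \<in> {1..d}"
  shows "word_cylinder d (a # w) \<subseteq> cylinder d a"
  using assms by (auto simp: word_cylinder_def cylinder_eq)

lemma prepend_in_word_cylinder_Cons:
  assumes "a \<in> {1..d}"
  shows "prepend a x \<in> word_cylinder d (a # w) \<longleftrightarrow> x \<in> word_cylinder d w"
proof -
  have "prepend a x \<in> Omega d \<longleftrightarrow> x \<in> Omega d"
    using assms prepend_in_Omega shift_in_Omega[of "prepend a x" d] by auto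
  then show ?thesis
    by (auto simp: word_cylinder_def prepend_def nth_Cons less_Suc_eq_0_disj split: nat.split)
qed

lemma shift_image_eq:
  assumes "a \<in> {1..d}" "B \<subseteq> cylinder d a"
  shows "shift ` B = {x \<in> Omega d. prepend a x \<in> B}"
proof (intro equalityI subsetI)
  fix x assume "x \<in> shift ` B"
  then obtain y where y: "y \<in> B" "x = shift y" by blast
  then have "y \<in> Omega d" "y 0 = a" using assms by (auto simp: cylinder_eq)
  then show "x \<in> {x \<in> Omega d. prepend a x \<in> B}"
    using y prepend_shift[of y] shift_in_Omega by auto
next
  fix x assume "x \<in> {x \<in> Omega d. prepend a x \<in> B}"
  then show "x \<in> shift ` B" by (auto intro!: image_eqI[of _ shift "prepend a x"])
qed

lemma shift_image_word_cylinder: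
  assumes "a \<in> {1..d}"
  shows "shift ` word_cylinder d (a # w) = word_cylinder d w"
  using shift_image_eq[OF assms word_cylinder_Cons_subset[OF assms]]
    prepend_in_word_cylinder_Cons[OF assms] word_cylinder_subset_Omega[of d w] by auto

lemma continuous_map_shift: "continuous_map (Omega_topology d) (Omega_topology d) shift"
  unfolding continuous_map_def
proof (intro conjI allI impI)
  fix U assume U: "openin (Omega_topology d) U"
  show "openin (Omega_topology d) {x \<in> topspace (Omega_topology d). shift x \<in> U}"
    unfolding openin_Omega_iff
  proof (intro conjI ballI)
    fix x assume "x \<in> {x \<in> topspace (Omega_topology d). shift x \<in> U}"
    then obtain n where n: "word_cylinder d (map (shift x) [0..<n]) \<subseteq> U"
      using U unfolding openin_Omega_iff by blast
    have "shift y \<in> word_cylinder d (map (shift x) [0..<n])"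
      if "y \<in> word_cylinder d (map x [0..<Suc n])" for y
      using that unfolding mem_word_cylinder_prefix by (auto simp: shift_def Omega_def)
    then show "\<exists>n. word_cylinder d (map x [0..<n])
        \<subseteq> {x \<in> topspace (Omega_topology d). shift x \<in> U}"
      using n word_cylinder_subset_Omega[of d "map x [0..<Suc n]"]
      by (intro exI[of _ "Suc n"] subsetI) (metis (mono_tags, lifting) mem_Collect_eq subsetD topspace_Omega)
  qed auto
qed (auto intro: shift_in_Omega)

lemma continuous_map_prepend:
  assumes a: "a \<in> {1..d}"
  shows "continuous_map (Omega_topology d) (Omega_topology d) (prepend a)"
  unfolding continuous_map_def
proof (intro conjI allI impI)
  fix U assume U: "openin (Omega_topology d) U"
  show "openin (Omega_topology d) {x \<in> topspace (Omega_topology d). prepend a x \<in> U}"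
    unfolding openin_Omega_iff
  proof (intro conjI ballI)
    fix x assume "x \<in> {x \<in> topspace (Omega_topology d). prepend a x \<in> U}"
    then obtain n where n: "word_cylinder d (map (prepend a x) [0..<n]) \<subseteq> U"
      using U unfolding openin_Omega_iff by blast
    have "prepend a y \<in> word_cylinder d (map (prepend a x) [0..<n])"
      if "y \<in> word_cylinder d (map x [0..<n])" for y
      using that prepend_in_Omega[OF a] unfolding mem_word_cylinder_prefix
      by (auto simp: prepend_def split: nat.split)
    then show "\<exists>n. word_cylinder d (map x [0..<n])
        \<subseteq> {x \<in> topspace (Omega_topology d). prepend a x \<in> U}"
      using n word_cylinder_subset_Omega[of d "map x [0..<n]"]
      by (intro exI[of _ n] subsetI) (metis (mono_tags, lifting) mem_Collect_eq subsetD topspace_Omega)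
  qed auto
qed (use a in \<open>auto intro: prepend_in_Omega\<close>)

lemma continuous_Omega_shift:
  "continuous_Omega d f \<Longrightarrow> continuous_Omega d (\<lambda>x. f (shift x))"
  unfolding continuous_Omega_def
  using continuous_map_compose[OF continuous_map_shift] by (simp add: o_def)

lemma continuous_Omega_mult:
  "continuous_Omega d f \<Longrightarrow> continuous_Omega d g \<Longrightarrow> continuous_Omega d (\<lambda>x. f x * g x)"
  unfolding continuous_Omega_def by (rule continuous_map_real_mult)

lemma continuous_Omega_compose_pos:
  assumes f: "continuous_Omega d f" "\<forall>x\<in>Omega d. 0 < f x" and h: "continuous_on {0<..} h"
  shows "continuous_Omega d (\<lambda>x. h (f x))"
proof -
  have "continuous_map (Omega_topology d) (top_of_set {0<..}) f"
    using f unfolding continuous_Omega_def by (intro continuous_map_into_subtopology) auto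
  moreover have "continuous_map (top_of_set {0<..}) euclideanreal h"
    using h by simp
  ultimately have "continuous_map (Omega_topology d) euclideanreal (h \<circ> f)"
    by (rule continuous_map_compose)
  then show ?thesis by (simp add: continuous_Omega_def o_def)
qed

lemma continuous_Omega_inverse:
  "continuous_Omega d f \<Longrightarrow> \<forall>x\<in>Omega d. 0 < f x \<Longrightarrow> continuous_Omega d (\<lambda>x. inverse (f x))"
  by (rule continuous_Omega_compose_pos[where h = inverse])
     (auto intro: continuous_on_inverse continuous_on_id)

lemma continuous_Omega_ln:
  "continuous_Omega d f \<Longrightarrow> \<forall>x\<in>Omega d. 0 < f x \<Longrightarrow> continuous_Omega d (\<lambda>x. ln (f x))"
  by (rule continuous_Omega_compose_pos[where h = ln])
     (auto intro: continuous_on_ln continuous_on_id)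

lemma continuous_Omega_indicator_word_cylinder:
  "continuous_Omega d (indicator (word_cylinder d w) :: _ \<Rightarrow> real)"
  unfolding continuous_Omega_def continuous_map_def
proof (intro conjI allI impI)
  fix U :: "real set" assume "openin euclideanreal U"
  let ?S = "{x \<in> topspace (Omega_topology d). (indicator (word_cylinder d w) x :: real) \<in> U}"
  show "openin (Omega_topology d) ?S"
    unfolding openin_Omega_iff
  proof (intro conjI ballI)
    fix x assume "x \<in> ?S"
    moreover have "indicator (word_cylinder d w) y = (indicator (word_cylinder d w) x :: real)"
      if "y \<in> word_cylinder d (map x [0..<length w])" for y
      using that \<open>x \<in> ?S\<close> unfolding mem_word_cylinder_prefix
      by (simp add: indicator_def word_cylinder_def)
    ultimately show "\<exists>n. word_cylinder d (map x [0..<n]) \<subseteq> ?S"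
      using word_cylinder_subset_Omega[of d "map x [0..<length w]"]
      by (intro exI[of _ "length w"] subsetI) (metis (mono_tags, lifting) mem_Collect_eq subsetD topspace_Omega)
  qed auto
qed auto

section \<open>Borel probabilities on the sequence space\<close>

lemma space_Omega_borel [simp]: "space (Omega_borel d) = Omega d"
  unfolding Omega_borel_def by (rule space_measure_of) (use openin_subset_Omega in blast)

lemma sets_Omega_borel:
  "sets (Omega_borel d) = sigma_sets (Omega d) {U. openin (Omega_topology d) U}"
  unfolding Omega_borel_def by (rule sets_measure_of) (use openin_subset_Omega in blast)

lemma sets_Omega_borel_open: "openin (Omega_topology d) U \<Longrightarrow> U \<in> sets (Omega_borel d)"
  by (auto simp: sets_Omega_borel)

text \<open>An open set is the union of the word cylinders that it contains, and there are only countably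
  many words.\<close>

lemma sets_Omega_borel_cylinders:
  "sets (Omega_borel d) = sigma_sets (Omega d) (range (word_cylinder d))"
proof -
  have "U \<in> sigma_sets (Omega d) (range (word_cylinder d))"
    if U: "openin (Omega_topology d) U" for U
  proof -
    let ?W = "{w. word_cylinder d w \<subseteq> U}"
    have "x \<in> (\<Union>w\<in>?W. word_cylinder d w)" if "x \<in> U" for x
    proof -
      obtain n where "word_cylinder d (map x [0..<n]) \<subseteq> U"
        using U \<open>x \<in> U\<close> unfolding openin_Omega_iff by blast
      moreover have "x \<in> word_cylinder d (map x [0..<n])"
        using openin_subset[OF U] \<open>x \<in> U\<close> by (auto simp: mem_word_cylinder_prefix)
      ultimately show ?thesis by blast
    qed
    then have "U = (\<Union>w\<in>?W. word_cylinder d w)" by blast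
    moreover have "(\<Union>w\<in>?W. word_cylinder d w) \<in> sigma_sets (Omega d) (range (word_cylinder d))"
      by (rule sigma_sets_UNION) auto
    ultimately show ?thesis by simp
  qed
  then have "sigma_sets (Omega d) {U. openin (Omega_topology d) U}
      \<subseteq> sigma_sets (Omega d) (range (word_cylinder d))"
    by (intro sigma_sets_mono) auto
  moreover have "sigma_sets (Omega d) (range (word_cylinder d))
      \<subseteq> sigma_sets (Omega d) {U. openin (Omega_topology d) U}"
    by (rule sigma_sets_mono') (auto intro: openin_word_cylinder)
  ultimately show ?thesis by (simp add: sets_Omega_borel)
qed

lemma measurable_Omega_self:
  assumes "continuous_map (Omega_topology d) (Omega_topology d) f"
  shows "f \<in> measurable (Omega_borel d) (Omega_borel d)"
proof (rule measurable_sigma_sets[OF sets_Omega_borel])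
  show "f -` U \<inter> space (Omega_borel d) \<in> sets (Omega_borel d)"
    if "U \<in> {U. openin (Omega_topology d) U}" for U
  proof -
    have "{x \<in> Omega d. f x \<in> U} \<in> sets (Omega_borel d)"
      using openin_continuous_map_preimage[OF assms, of U] that
      by (auto intro: sets_Omega_borel_open)
    moreover have "f -` U \<inter> space (Omega_borel d) = {x \<in> Omega d. f x \<in> U}" by auto
    ultimately show ?thesis by simp
  qed
  show "f \<in> space (Omega_borel d) \<rightarrow> Omega d"
    using continuous_map_funspace[OF assms] by simp
qed (use openin_subset_Omega in blast)

lemma borel_measurable_continuous_Omega:
  assumes "continuous_Omega d f"
  shows "f \<in> borel_measurable (Omega_borel d)"
proof (rule borel_measurableI)
  fix S :: "real set" assume "open S"
  then have "{x \<in> Omega d. f x \<in> S} \<in> sets (Omega_borel d)"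
    using openin_continuous_map_preimage[OF assms[unfolded continuous_Omega_def], of S]
    by (auto intro: sets_Omega_borel_open)
  moreover have "f -` S \<inter> space (Omega_borel d) = {x \<in> Omega d. f x \<in> S}" by auto
  ultimately show "f -` S \<inter> space (Omega_borel d) \<in> sets (Omega_borel d)" by simp
qed

lemma space_borel_probability: "borel_probability d \<mu> \<Longrightarrow> space \<mu> = Omega d"
  by (metis borel_probability_def sets_eq_imp_space_eq space_Omega_borel)

lemma measurable_borel_probability:
  "borel_probability d \<mu> \<Longrightarrow> f \<in> measurable (Omega_borel d) N \<Longrightarrow> f \<in> measurable \<mu> N"
  unfolding borel_probability_def using measurable_cong_sets by blast

lemma integrable_bounded_Omega:
  fixes f :: "_ \<Rightarrow> real"
  assumes "borel_probability d \<mu>" "f \<in> borel_measurable (Omega_borel d)"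
    and "\<And>x. x \<in> Omega d \<Longrightarrow> \<bar>f x\<bar> \<le> B"
  shows "integrable \<mu> f"
proof -
  interpret prob_space \<mu> using assms(1) by (simp add: borel_probability_def)
  show ?thesis
    by (rule integrable_const_bound[of _ B])
       (use assms in \<open>auto simp: space_borel_probability intro: measurable_borel_probability\<close>)
qed

lemma integrable_continuous_Omega:
  assumes "borel_probability d \<mu>" "continuous_Omega d f"
  shows "integrable \<mu> f"
proof -
  obtain B where "\<forall>x\<in>Omega d. \<bar>f x\<bar> \<le> B"
    using continuous_Omega_bounded[OF assms(2)] by blast
  then show ?thesis
    by (intro integrable_bounded_Omega[of d _ _ B] assms borel_measurable_continuous_Omega) auto
qed

lemma integrable_indicator_continuous_Omega:
  assumes "borel_probability d \<mu>" "continuous_Omega d f" "A \<in> sets (Omega_borel d)"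
  shows "integrable \<mu> (\<lambda>x. indicator A x * f x)"
  using integrable_real_mult_indicator[OF _ integrable_continuous_Omega[OF assms(1,2)], of A] assms
  by (simp add: borel_probability_def mult.commute)

text \<open>Indicators of word cylinders are continuous, so the two measures agree on word cylinders. Two
  word cylinders are nested or disjoint, which makes them an intersection-stable generator.\<close>

lemma borel_probability_eqI:
  assumes \<mu>: "borel_probability d \<mu>" and \<nu>: "borel_probability d \<nu>"
    and eq: "\<And>\<phi>. continuous_Omega d \<phi> \<Longrightarrow> (LINT x|\<mu>. \<phi> x) = (LINT x|\<nu>. \<phi> x)"
  shows "\<mu> = \<nu>"
proof (rule measure_eqI_generator_eq[of "range (word_cylinder d)" "Omega d" _ _ "\<lambda>_. Omega d"])
  interpret M: prob_space \<mu> using \<mu> by (simp add: borel_probability_def)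
  interpret N: prob_space \<nu> using \<nu> by (simp add: borel_probability_def)
  have "word_cylinder d v \<inter> word_cylinder d w \<in> range (word_cylinder d)"
    if "length v \<le> length w" for v w
  proof (cases "take (length v) w = v")
    case True
    then have "v ! i = w ! i" if "i < length v" for i
      using that by (metis nth_take)
    then have "word_cylinder d v \<inter> word_cylinder d w = word_cylinder d w"
      using \<open>length v \<le> length w\<close> by (auto simp: word_cylinder_def)
    then show ?thesis by simp
  next
    case False
    then obtain i where "i < length v" "w ! i \<noteq> v ! i"
      using \<open>length v \<le> length w\<close> by (auto simp: list_eq_iff_nth_eq)
    then have "word_cylinder d v \<inter> word_cylinder d w = {}"
      using \<open>length v \<le> length w\<close> by (fastforce simp: word_cylinder_def)
    \<comment> \<open>The letter 0 is not in the alphabet, so this word has an empty cylinder.\<close>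
    also have "{} = word_cylinder d [0]"
      by (fastforce simp: word_cylinder_def Omega_def dest: spec[of _ 0])
    finally show ?thesis by simp
  qed
  then show "Int_stable (range (word_cylinder d))"
    unfolding Int_stable_def by (metis Int_commute imageE linear)
  show "range (word_cylinder d) \<subseteq> Pow (Omega d)"
    using word_cylinder_subset_Omega by auto
  show "sets \<mu> = sigma_sets (Omega d) (range (word_cylinder d))"
       "sets \<nu> = sigma_sets (Omega d) (range (word_cylinder d))"
    using \<mu> \<nu> by (simp_all add: borel_probability_def sets_Omega_borel_cylinders)
  have "word_cylinder d [] = Omega d" by (auto simp: word_cylinder_def)
  then show "range (\<lambda>_::nat. Omega d) \<subseteq> range (word_cylinder d)" by auto
  show "emeasure \<mu> X = emeasure \<nu> X" if X: "X \<in> range (word_cylinder d)" for X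
  proof -
    obtain w where w: "X = word_cylinder d w" using X by blast
    then have "X \<in> sets (Omega_borel d)"
      by (simp add: openin_word_cylinder sets_Omega_borel_open)
    then have "X \<in> sets \<mu>" "X \<in> sets \<nu>" using \<mu> \<nu> by (simp_all add: borel_probability_def)
    then have "measure \<mu> X = measure \<nu> X"
      using eq[OF continuous_Omega_indicator_word_cylinder[of d w]] w by simp
    then show ?thesis by (simp add: M.emeasure_eq_measure N.emeasure_eq_measure)
  qed
  show "emeasure \<mu> (Omega d) \<noteq> \<infinity>" by (simp add: M.emeasure_eq_measure)
qed auto

section \<open>Change of variables along the inverse branches\<close>

lemma cylinder_in_sets:
  assumes "a \<in> {1..d}"
  shows "cylinder d a \<in> sets (Omega_borel d)"
proof -
  have "cylinder d a = word_cylinder d [a]"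
    using assms by (auto simp: cylinder_eq word_cylinder_def)
  then show ?thesis by (simp add: openin_word_cylinder sets_Omega_borel_open)
qed

lemma is_IRN_continuous_inverse:
  "is_IRN d \<mu> K \<Longrightarrow> continuous_Omega d (\<lambda>x. inverse (K x))"
  by (simp add: is_IRN_def continuous_Omega_inverse)

text \<open>For \<open>B \<subseteq> cylinder d a\<close> the set \<open>shift ` B\<close> is the preimage of \<open>B\<close> under \<open>prepend a\<close>, so
  the IRN identity computes the image measure on subsets of the cylinder; outside the cylinder the
  image measure vanishes.\<close>

lemma distr_prepend:
  assumes \<mu>: "borel_probability d \<mu>" and K: "is_IRN d \<mu> K" and a: "a \<in> {1..d}"
  shows "distr \<mu> (Omega_borel d) (prepend a) =
    density \<mu> (\<lambda>y. ennreal (indicator (cylinder d a) y * inverse (K y)))"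
proof (rule measure_eqI)
  interpret prob_space \<mu> using \<mu> by (simp add: borel_probability_def)
  have sets: "sets \<mu> = sets (Omega_borel d)" using \<mu> by (simp add: borel_probability_def)
  show "sets (distr \<mu> (Omega_borel d) (prepend a)) =
    sets (density \<mu> (\<lambda>y. ennreal (indicator (cylinder d a) y * inverse (K y))))"
    by (simp add: sets)
  fix A assume "A \<in> sets (distr \<mu> (Omega_borel d) (prepend a))"
  then have A: "A \<in> sets (Omega_borel d)" by simp
  let ?B = "A \<inter> cylinder d a"
  have B: "?B \<in> sets (Omega_borel d)" using A cylinder_in_sets[OF a] by blast
  have int: "integrable \<mu> (\<lambda>x. indicator ?B x * inverse (K x))"
    by (rule integrable_indicator_continuous_Omega[OF \<mu> is_IRN_continuous_inverse[OF K] B])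
  have nonneg: "0 \<le> indicator ?B x * inverse (K x)" if "x \<in> Omega d" for x
    using K that by (auto simp: is_IRN_def indicator_def intro: less_imp_le)
  have meas: "(\<lambda>y. ennreal (indicator (cylinder d a) y * inverse (K y))) \<in> borel_measurable \<mu>"
    using integrable_indicator_continuous_Omega[OF \<mu> is_IRN_continuous_inverse[OF K]
      cylinder_in_sets[OF a]] by (intro measurable_compose[OF _ measurable_ennreal]) auto
  have prep: "prepend a \<in> measurable \<mu> (Omega_borel d)"
    by (intro measurable_borel_probability[OF \<mu>] measurable_Omega_self continuous_map_prepend a)
  have "shift ` ?B = {x \<in> Omega d. prepend a x \<in> ?B}"
    by (rule shift_image_eq[OF a]) simp
  then have "prepend a -` A \<inter> space \<mu> = shift ` ?B"
    by (auto simp: space_borel_probability[OF \<mu>] cylinder_def)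
  then have "emeasure (distr \<mu> (Omega_borel d) (prepend a)) A = measure \<mu> (shift ` ?B)"
    using A prep by (simp add: emeasure_distr emeasure_eq_measure)
  also have "measure \<mu> (shift ` ?B) = (LINT x|\<mu>. indicator ?B x * inverse (K x))"
    using K a B by (auto simp: is_IRN_def set_lebesgue_integral_def)
  also have "ennreal \<dots> = (\<integral>\<^sup>+x. ennreal (indicator ?B x * inverse (K x)) \<partial>\<mu>)"
  proof (rule nn_integral_eq_integral[symmetric, OF int])
    show "AE x in \<mu>. 0 \<le> indicator ?B x * inverse (K x)"
      by (rule AE_I2, rule nonneg) (simp add: space_borel_probability[OF \<mu>])
  qed
  also have "\<dots> = (\<integral>\<^sup>+x. ennreal (indicator (cylinder d a) x * inverse (K x)) * indicator A x \<partial>\<mu>)"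
    by (intro nn_integral_cong) (auto simp: indicator_def)
  also have "\<dots> = emeasure (density \<mu> (\<lambda>y. ennreal (indicator (cylinder d a) y * inverse (K y)))) A"
    using A meas sets by (subst emeasure_density) auto
  finally show "emeasure (distr \<mu> (Omega_borel d) (prepend a)) A =
    emeasure (density \<mu> (\<lambda>y. ennreal (indicator (cylinder d a) y * inverse (K y)))) A" .
qed

lemma integral_prepend:
  fixes f :: "(nat \<Rightarrow> nat) \<Rightarrow> real"
  assumes \<mu>: "borel_probability d \<mu>" and K: "is_IRN d \<mu> K" and a: "a \<in> {1..d}"
    and f: "f \<in> borel_measurable (Omega_borel d)"
  shows "(LINT x|\<mu>. f (prepend a x)) =
    (LINT y|\<mu>. indicator (cylinder d a) y * inverse (K y) * f y)"
proof -
  have prep: "prepend a \<in> measurable \<mu> (Omega_borel d)"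
    by (intro measurable_borel_probability[OF \<mu>] measurable_Omega_self continuous_map_prepend a)
  have meas: "(\<lambda>y. indicator (cylinder d a) y * inverse (K y)) \<in> borel_measurable \<mu>"
    using integrable_indicator_continuous_Omega[OF \<mu> is_IRN_continuous_inverse[OF K]
      cylinder_in_sets[OF a]] by auto
  have nonneg: "AE y in \<mu>. 0 \<le> indicator (cylinder d a) y * inverse (K y)"
    using K by (intro AE_I2)
      (auto simp: is_IRN_def space_borel_probability[OF \<mu>] indicator_def intro: less_imp_le)
  have "(LINT x|\<mu>. f (prepend a x)) = integral\<^sup>L (distr \<mu> (Omega_borel d) (prepend a)) f"
    by (rule integral_distr[OF prep f, symmetric])
  also have "\<dots> = (LINT y|\<mu>. indicator (cylinder d a) y * inverse (K y) * f y)"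
    unfolding distr_prepend[OF \<mu> K a]
    using integral_density[OF measurable_borel_probability[OF \<mu> f] meas nonneg] by simp
  finally show ?thesis .
qed

section \<open>Uniqueness of the inverse Radon--Nikodym derivative\<close>

text \<open>Full support. The shift maps the cylinder of \<open>a # w\<close> onto that of \<open>w\<close>, and the IRN identity
  shows that the image of a null set is null; so positivity passes from \<open>w\<close> to \<open>a # w\<close>.\<close>

lemma measure_word_cylinder_pos:
  assumes \<mu>: "borel_probability d \<mu>" and K: "is_IRN d \<mu> K"
  shows "set w \<subseteq> {1..d} \<Longrightarrow> 0 < measure \<mu> (word_cylinder d w)"
proof (induction w)
  case Nil
  interpret prob_space \<mu> using \<mu> by (simp add: borel_probability_def)
  have "word_cylinder d [] = space \<mu>"
    by (auto simp: word_cylinder_def space_borel_probability[OF \<mu>])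
  then show ?case by (simp add: prob_space)
next
  case (Cons a w)
  then have a: "a \<in> {1..d}" by simp
  let ?C = "word_cylinder d (a # w)"
  have C: "?C \<in> sets (Omega_borel d)" by (simp add: openin_word_cylinder sets_Omega_borel_open)
  have eq: "measure \<mu> (word_cylinder d w) = (LINT x:?C|\<mu>. inverse (K x))"
    using K a C word_cylinder_Cons_subset[OF a] shift_image_word_cylinder[OF a]
    unfolding is_IRN_def by metis
  interpret prob_space \<mu> using \<mu> by (simp add: borel_probability_def)
  have "measure \<mu> ?C \<noteq> 0"
  proof
    assume "measure \<mu> ?C = 0"
    then have "?C \<in> null_sets \<mu>"
      using C \<mu> by (auto simp: null_sets_def emeasure_eq_measure borel_probability_def)
    then have "AE x in \<mu>. indicator ?C x *\<^sub>R inverse (K x) = 0"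
      by (rule AE_not_in[THEN eventually_mono]) simp
    then have "(LINT x:?C|\<mu>. inverse (K x)) = 0"
      unfolding set_lebesgue_integral_def by (rule integral_eq_zero_AE)
    then show False using eq Cons by simp
  qed
  then show ?case by (simp add: less_le)
qed

text \<open>If \<open>K x > L x\<close>, then \<open>inverse L > inverse K\<close> on a small cylinder around \<open>x\<close>, which has positive
  measure; but both functions have the same integral there.\<close>

lemma is_IRN_le:
  assumes \<mu>: "borel_probability d \<mu>" and K: "is_IRN d \<mu> K" and L: "is_IRN d \<mu> L"
    and x: "x \<in> Omega d"
  shows "K x \<le> L x"
proof (rule ccontr)
  assume "\<not> K x \<le> L x"
  define g where "g y = inverse (L y) - inverse (K y)" for y
  have gx: "g x > 0"
    using \<open>\<not> K x \<le> L x\<close> L x by (auto simp: g_def is_IRN_def intro!: less_imp_inverse_less)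
  have g: "continuous_Omega d g"
    using is_IRN_continuous_inverse[OF K] is_IRN_continuous_inverse[OF L]
    unfolding continuous_Omega_def g_def by (rule continuous_map_diff[rotated])
  have "openin (Omega_topology d) {y \<in> Omega d. g y \<in> {0<..}}"
    using openin_continuous_map_preimage[OF g[unfolded continuous_Omega_def], of "{0<..}"] by simp
  moreover have "x \<in> {y \<in> Omega d. g y \<in> {0<..}}" using x gx by simp
  ultimately obtain n where n: "word_cylinder d (map x [0..<n]) \<subseteq> {y \<in> Omega d. g y \<in> {0<..}}"
    unfolding openin_Omega_iff by blast
  \<comment> \<open>One letter more than \<open>n\<close>, so that the cylinder lies in a single branch even if \<open>n = 0\<close>.\<close>
  define C where "C = word_cylinder d (map x [0..<Suc n])"
  have pos: "g y > 0" if "y \<in> C" for y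
  proof -
    have "y \<in> word_cylinder d (map x [0..<n])"
      using that unfolding C_def mem_word_cylinder_prefix by simp
    then show ?thesis using n by auto
  qed
  have x0: "x 0 \<in> {1..d}" using x unfolding Omega_def by blast
  have Csub: "C \<subseteq> cylinder d (x 0)"
    unfolding C_def cylinder_eq[OF x0] by (auto simp: mem_word_cylinder_prefix simp del: upt_Suc)
  have C: "C \<in> sets (Omega_borel d)"
    unfolding C_def by (intro sets_Omega_borel_open openin_word_cylinder)
  have C': "C \<in> sets \<mu>" using C \<mu> by (simp add: borel_probability_def)
  have "set (map x [0..<Suc n]) \<subseteq> {1..d}" using x by (auto simp: Omega_def simp del: upt_Suc)
  then have measC: "0 < measure \<mu> C"
    unfolding C_def by (rule measure_word_cylinder_pos[OF \<mu> K])
  have int: "integrable \<mu> (\<lambda>y. indicator C y * g y)"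
    by (rule integrable_indicator_continuous_Omega[OF \<mu> g C])
  have "(LINT y|\<mu>. indicator C y * g y) = (LINT y:C|\<mu>. inverse (L y)) - (LINT y:C|\<mu>. inverse (K y))"
    unfolding set_lebesgue_integral_def g_def right_diff_distrib
    using integrable_indicator_continuous_Omega[OF \<mu> is_IRN_continuous_inverse[OF K] C]
      integrable_indicator_continuous_Omega[OF \<mu> is_IRN_continuous_inverse[OF L] C] by simp
  also have "\<dots> = 0"
    using K L x0 C Csub unfolding is_IRN_def by (metis diff_self)
  finally have "(LINT y|\<mu>. indicator C y * g y) = 0" .
  moreover have "AE y in \<mu>. 0 \<le> indicator C y * g y"
    using pos by (intro AE_I2) (auto simp: indicator_def less_imp_le)
  ultimately have "AE y in \<mu>. indicator C y * g y = 0"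
    using integral_nonneg_eq_0_iff_AE[OF int] by simp
  then have "AE y in \<mu>. y \<notin> C"
    by eventually_elim (use pos in \<open>force simp: indicator_def\<close>)
  then have "emeasure \<mu> C = 0"
    using C' by (simp add: AE_iff_null_sets null_setsD1)
  then show False using measC by (simp add: measure_def)
qed

lemma IRN_eq:
  assumes \<mu>: "borel_probability d \<mu>" and K: "is_IRN d \<mu> K" and x: "x \<in> Omega d"
  shows "IRN d \<mu> x = K x"
proof -
  have cont: "continuous_Omega d (restrict K (Omega d))"
    using K unfolding is_IRN_def continuous_Omega_def
    by (auto intro: continuous_map_eq)
  have restr: "is_IRN d \<mu> (restrict K (Omega d))"
    unfolding is_IRN_def
  proof (intro conjI cont ballI impI)
    fix j B assume jB: "j \<in> {1..d}" "B \<in> sets (Omega_borel d)" "B \<subseteq> cylinder d j"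
    have "(LINT x:B|\<mu>. inverse (restrict K (Omega d) x)) = (LINT x:B|\<mu>. inverse (K x))"
      unfolding set_lebesgue_integral_def
      by (intro Bochner_Integration.integral_cong) (auto simp: space_borel_probability[OF \<mu>])
    then show "measure \<mu> (shift ` B) = (LINT x:B|\<mu>. inverse (restrict K (Omega d) x))"
      using K jB unfolding is_IRN_def by simp
  qed (use K in \<open>auto simp: is_IRN_def\<close>)
  have "IRN d \<mu> = restrict K (Omega d)"
    unfolding IRN_def
  proof (rule the_equality)
    fix L assume L: "L \<in> extensional (Omega d) \<and> is_IRN d \<mu> L"
    show "L = restrict K (Omega d)"
    proof (rule extensionalityI)
      show "L y = restrict K (Omega d) y" if "y \<in> Omega d" for y
        using is_IRN_le[OF \<mu> K _ that, of L] is_IRN_le[OF \<mu> _ K that, of L] L that by simp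
    qed (use L in auto)
  qed (use restr in simp)
  then show ?thesis using x by simp
qed

section \<open>The dual Ruelle operator\<close>

text \<open>Each term of \<open>ruelle d J \<phi>\<close> is transported to its branch by the change of variables; the
  branches partition the space, so the indicators add up to 1.\<close>

lemma integral_ruelle:
  assumes \<mu>: "borel_probability d \<mu>" and K: "is_IRN d \<mu> K"
    and J: "continuous_Omega d J" and \<phi>: "continuous_Omega d \<phi>"
  shows "(LINT x|\<mu>. ruelle d J \<phi> x) = (LINT x|\<mu>. J x * inverse (K x) * \<phi> x)"
proof -
  let ?f = "\<lambda>y. J y * \<phi> y"
  let ?g = "\<lambda>a y. indicator (cylinder d a) y * inverse (K y) * ?f y"
  have f: "continuous_Omega d ?f" by (intro continuous_Omega_mult J \<phi>)
  have "integrable \<mu> (\<lambda>x. ?f (prepend a x))" if "a \<in> {1..d}" for a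
    using continuous_map_compose[OF continuous_map_prepend[OF that] f[unfolded continuous_Omega_def]]
    by (intro integrable_continuous_Omega[OF \<mu>]) (simp add: continuous_Omega_def o_def)
  then have "(LINT x|\<mu>. ruelle d J \<phi> x) = (\<Sum>a=1..d. LINT x|\<mu>. ?f (prepend a x))"
    unfolding ruelle_def by (intro Bochner_Integration.integral_sum) auto
  also have "\<dots> = (\<Sum>a=1..d. LINT y|\<mu>. ?g a y)"
    by (intro sum.cong refl integral_prepend[OF \<mu> K] borel_measurable_continuous_Omega[OF f])
  also have "\<dots> = (LINT y|\<mu>. (\<Sum>a=1..d. ?g a y))"
  proof (rule Bochner_Integration.integral_sum[symmetric])
    fix a assume "a \<in> {1..d}"
    then show "integrable \<mu> (?g a)"
      using integrable_indicator_continuous_Omega[OF \<mu> continuous_Omega_mult[OF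
        is_IRN_continuous_inverse[OF K] f] cylinder_in_sets[of a]] by (simp add: mult.assoc)
  qed
  also have "\<dots> = (LINT y|\<mu>. J y * inverse (K y) * \<phi> y)"
  proof (intro Bochner_Integration.integral_cong refl)
    fix y assume "y \<in> space \<mu>"
    then have y: "y \<in> Omega d" by (simp add: space_borel_probability[OF \<mu>])
    then have y0: "y 0 \<in> {1..d}" unfolding Omega_def by blast
    have "(\<Sum>a=1..d. ?g a y) = (\<Sum>a=1..d. if a = y 0 then inverse (K y) * ?f y else 0)"
      using y by (intro sum.cong refl) (auto simp: cylinder_eq indicator_def)
    also have "\<dots> = inverse (K y) * ?f y" using y0 by simp
    finally show "(\<Sum>a=1..d. ?g a y) = J y * inverse (K y) * \<phi> y" by (simp add: ac_simps)
  qed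
  finally show ?thesis .
qed

lemma Jacobian_continuous: "Jacobian d J \<Longrightarrow> continuous_Omega d J"
  by (simp add: Jacobian_def)

lemma Jacobian_pos: "Jacobian d J \<Longrightarrow> \<forall>x\<in>Omega d. 0 < J x"
  by (auto simp: Jacobian_def)

lemma quotient_pos:
  "is_IRN d \<mu> K \<Longrightarrow> Jacobian d J \<Longrightarrow> x \<in> Omega d \<Longrightarrow> 0 < J x * inverse (K x)"
  by (simp add: is_IRN_def Jacobian_def)

text \<open>All preimages of \<open>x\<close> have the same shift \<open>x\<close>, so \<open>g x\<close> factors out and the weights add up
  to 1.\<close>

lemma ruelle_shift:
  assumes "Jacobian d J" "x \<in> Omega d"
  shows "ruelle d J (\<lambda>x. g (shift x)) x = g x"
  using assms by (simp add: ruelle_def Jacobian_def flip: sum_distrib_right)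

lemma integral_density_quotient:
  fixes f :: "(nat \<Rightarrow> nat) \<Rightarrow> real"
  assumes \<mu>: "borel_probability d \<mu>" and K: "is_IRN d \<mu> K" and J: "Jacobian d J"
    and f: "f \<in> borel_measurable (Omega_borel d)"
  shows "(LINT x|density \<mu> (\<lambda>x. ennreal (J x * inverse (K x))). f x) =
    (LINT x|\<mu>. J x * inverse (K x) * f x)"
proof -
  have "(\<lambda>x. J x * inverse (K x)) \<in> borel_measurable \<mu>"
    by (intro measurable_borel_probability[OF \<mu>] borel_measurable_continuous_Omega
        continuous_Omega_mult Jacobian_continuous[OF J] is_IRN_continuous_inverse[OF K])
  moreover have "AE x in \<mu>. 0 \<le> J x * inverse (K x)"
    using quotient_pos[OF K J]
    by (intro AE_I2) (simp add: space_borel_probability[OF \<mu>] less_imp_le)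
  ultimately show ?thesis
    using integral_density[OF measurable_borel_probability[OF \<mu> f]] by simp
qed

text \<open>By the change of variables the density \<open>J / K\<close> satisfies the duality relation, and a Borel
  probability that satisfies it is unique.\<close>

lemma ruelle_dual_eq_density:
  assumes \<mu>: "borel_probability d \<mu>" and K: "is_IRN d \<mu> K" and J: "Jacobian d J"
  shows "borel_probability d (ruelle_dual d J \<mu>)"
    and "ruelle_dual d J \<mu> = density \<mu> (\<lambda>x. ennreal (J x * inverse (K x)))"
proof -
  let ?\<nu> = "density \<mu> (\<lambda>x. ennreal (J x * inverse (K x)))"
  have hc: "continuous_Omega d (\<lambda>x. J x * inverse (K x))"
    by (intro continuous_Omega_mult Jacobian_continuous[OF J] is_IRN_continuous_inverse[OF K])
  have h: "(\<lambda>x. J x * inverse (K x)) \<in> borel_measurable \<mu>"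
    by (intro measurable_borel_probability[OF \<mu>] borel_measurable_continuous_Omega hc)
  have nonneg: "AE x in \<mu>. 0 \<le> J x * inverse (K x)"
    using quotient_pos[OF K J]
    by (intro AE_I2) (simp add: space_borel_probability[OF \<mu>] less_imp_le)
  have dual: "(LINT x|?\<nu>. \<phi> x) = (LINT x|\<mu>. ruelle d J \<phi> x)" if "continuous_Omega d \<phi>" for \<phi>
    using integral_density_quotient[OF \<mu> K J borel_measurable_continuous_Omega[OF that]]
      integral_ruelle[OF \<mu> K Jacobian_continuous[OF J] that] by simp
  \<comment> \<open>The density has total mass 1 because \<open>ruelle d J\<close> fixes the constant function 1.\<close>
  have one: "(LINT x|\<mu>. J x * inverse (K x)) = 1"
  proof -
    interpret prob_space \<mu> using \<mu> by (simp add: borel_probability_def)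
    have "continuous_Omega d (\<lambda>_. 1)" by (simp add: continuous_Omega_def)
    from integral_ruelle[OF \<mu> K Jacobian_continuous[OF J] this]
    have "(LINT x|\<mu>. J x * inverse (K x)) = (LINT x|\<mu>. ruelle d J (\<lambda>_. 1) x)" by simp
    also have "\<dots> = (LINT x|\<mu>. 1)"
      using ruelle_shift[OF J, of _ "\<lambda>_. 1"]
      by (intro Bochner_Integration.integral_cong) (auto simp: space_borel_probability[OF \<mu>])
    finally show ?thesis by (simp add: prob_space)
  qed
  have bp: "borel_probability d ?\<nu>"
    unfolding borel_probability_def
  proof
    show "prob_space ?\<nu>"
    proof
      have "emeasure ?\<nu> (space ?\<nu>) = (\<integral>\<^sup>+x. ennreal (J x * inverse (K x)) \<partial>\<mu>)"
        using h by (subst emeasure_density) (auto intro!: nn_integral_cong)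
      also have "\<dots> = 1"
        using nn_integral_eq_integral[OF integrable_continuous_Omega[OF \<mu> hc] nonneg] one by simp
      finally show "emeasure ?\<nu> (space ?\<nu>) = 1" .
    qed
  qed (use \<mu> in \<open>simp add: borel_probability_def\<close>)
  show eq: "ruelle_dual d J \<mu> = ?\<nu>"
    unfolding ruelle_dual_def
  proof (rule the_equality)
    show "borel_probability d ?\<nu> \<and>
      (\<forall>\<phi>. continuous_Omega d \<phi> \<longrightarrow> (LINT x|?\<nu>. \<phi> x) = (LINT x|\<mu>. ruelle d J \<phi> x))"
      using bp dual by blast
    fix \<nu> assume "borel_probability d \<nu> \<and>
      (\<forall>\<phi>. continuous_Omega d \<phi> \<longrightarrow> (LINT x|\<nu>. \<phi> x) = (LINT x|\<mu>. ruelle d J \<phi> x))"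
    then show "\<nu> = ?\<nu>"
      using dual by (intro borel_probability_eqI[OF _ bp]) auto
  qed
  show "borel_probability d (ruelle_dual d J \<mu>)" using bp eq by simp
qed

lemma integral_ruelle_dual_shift:
  assumes \<mu>: "borel_probability d \<mu>" and K: "is_IRN d \<mu> K" and J: "Jacobian d J"
    and g: "continuous_Omega d g"
  shows "(LINT x|ruelle_dual d J \<mu>. g (shift x)) = (LINT x|\<mu>. g x)"
proof -
  have gs: "continuous_Omega d (\<lambda>x. g (shift x))" by (rule continuous_Omega_shift[OF g])
  have "(LINT x|ruelle_dual d J \<mu>. g (shift x)) = (LINT x|\<mu>. J x * inverse (K x) * g (shift x))"
    unfolding ruelle_dual_eq_density(2)[OF \<mu> K J]
    by (rule integral_density_quotient[OF \<mu> K J borel_measurable_continuous_Omega[OF gs]])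
  also have "\<dots> = (LINT x|\<mu>. ruelle d J (\<lambda>x. g (shift x)) x)"
    by (rule integral_ruelle[OF \<mu> K Jacobian_continuous[OF J] gs, symmetric])
  also have "\<dots> = (LINT x|\<mu>. g x)"
    by (intro Bochner_Integration.integral_cong refl ruelle_shift[OF J])
       (simp add: space_borel_probability[OF \<mu>])
  finally show ?thesis .
qed

text \<open>Passing to the equivalent measure with density \<open>h = J / K\<close> multiplies the IRN by the cocycle
  \<open>h x / h (shift x)\<close>, and \<open>K x * h x / h (shift x) = K (shift x) * J x / J (shift x)\<close>.\<close>

lemma is_IRN_ruelle_dual:
  assumes \<mu>: "borel_probability d \<mu>" and K: "is_IRN d \<mu> K" and J: "Jacobian d J"
  shows "is_IRN d (ruelle_dual d J \<mu>) (\<lambda>x. K (shift x) * J x * inverse (J (shift x)))"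
    (is "is_IRN d ?\<nu> ?L")
  unfolding is_IRN_def
proof (intro conjI ballI impI)
  have Jc: "continuous_Omega d J" and Kc: "continuous_Omega d K"
    using J K by (simp_all add: Jacobian_def is_IRN_def)
  have pos: "0 < J x" "0 < K x" if "x \<in> Omega d" for x
    using that K Jacobian_pos[OF J] by (simp_all add: is_IRN_def)
  show Lc: "continuous_Omega d ?L"
    by (intro continuous_Omega_mult Jc continuous_Omega_shift[OF Kc]
        continuous_Omega_shift[OF continuous_Omega_inverse[OF Jc Jacobian_pos[OF J]]])
  show Lpos: "0 < ?L x" if "x \<in> Omega d" for x
    using pos that by (simp add: shift_in_Omega)
  let ?h = "\<lambda>x. J x * inverse (K x)"
  have hc: "continuous_Omega d ?h"
    by (intro continuous_Omega_mult Jc is_IRN_continuous_inverse[OF K])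
  have int\<nu>: "(LINT x|?\<nu>. f x) = (LINT x|\<mu>. ?h x * f x)"
    if "f \<in> borel_measurable (Omega_borel d)" for f :: "_ \<Rightarrow> real"
    unfolding ruelle_dual_eq_density(2)[OF \<mu> K J]
    by (rule integral_density_quotient[OF \<mu> K J that])
  fix j B assume j: "j \<in> {1..d}" and B: "B \<in> sets (Omega_borel d)" and Bj: "B \<subseteq> cylinder d j"
  have sB: "shift ` B = prepend j -` B \<inter> space (Omega_borel d)"
    using shift_image_eq[OF j Bj] by auto
  have sB_sets: "shift ` B \<in> sets (Omega_borel d)"
    unfolding sB by (rule measurable_sets[OF measurable_Omega_self[OF continuous_map_prepend[OF j]] B])
  let ?f = "\<lambda>y. indicator B y * ?h (shift y) :: real"
  have f: "?f \<in> borel_measurable (Omega_borel d)"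
    using B by (intro borel_measurable_times borel_measurable_indicator
      borel_measurable_continuous_Omega[OF continuous_Omega_shift[OF hc]])
  have g: "(\<lambda>y. indicator B y * inverse (?L y) :: real) \<in> borel_measurable (Omega_borel d)"
    using B Lpos by (intro borel_measurable_times borel_measurable_indicator
      borel_measurable_continuous_Omega[OF continuous_Omega_inverse[OF Lc]]) blast+
  have "measure ?\<nu> (shift ` B) = (LINT x|?\<nu>. indicator (shift ` B) x)"
    using sB_sets ruelle_dual_eq_density(1)[OF \<mu> K J] by (simp add: borel_probability_def)
  also have "\<dots> = (LINT x|\<mu>. ?h x * indicator (shift ` B) x)"
    using sB_sets by (intro int\<nu>) auto
  also have "\<dots> = (LINT x|\<mu>. ?f (prepend j x))"
    by (intro Bochner_Integration.integral_cong)
       (auto simp: sB space_borel_probability[OF \<mu>] indicator_def)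
  also have "\<dots> = (LINT y|\<mu>. indicator (cylinder d j) y * inverse (K y) * ?f y)"
    by (rule integral_prepend[OF \<mu> K j f])
  also have "\<dots> = (LINT y|\<mu>. ?h y * (indicator B y * inverse (?L y)))"
  proof (intro Bochner_Integration.integral_cong refl)
    fix y assume "y \<in> space \<mu>"
    then have "y \<in> Omega d" by (simp add: space_borel_probability[OF \<mu>])
    then have "J y \<noteq> 0" using pos(1)[of y] by simp
    then show "indicator (cylinder d j) y * inverse (K y) * ?f y =
        ?h y * (indicator B y * inverse (?L y))"
      using Bj by (auto simp: indicator_def field_simps)
  qed
  also have "\<dots> = (LINT y|?\<nu>. indicator B y * inverse (?L y))"
    by (rule int\<nu>[OF g, symmetric])
  also have "\<dots> = (LINT y:B|?\<nu>. inverse (?L y))"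
    by (simp add: set_lebesgue_integral_def)
  finally show "measure ?\<nu> (shift ` B) = (LINT y:B|?\<nu>. inverse (?L y))" .
qed

section \<open>Invariance of the divergence\<close>

lemma D_KL_eq:
  assumes \<mu>: "borel_probability d \<mu>" "is_IRN d \<mu> K" and \<nu>: "borel_probability d \<nu>" "is_IRN d \<nu> L"
  shows "D_KL d \<mu> \<nu> = (LINT x|\<mu>. ln (K x) - ln (L x))"
proof -
  have "(LINT x|\<mu>. ln (IRN d \<mu> x)) = (LINT x|\<mu>. ln (K x))"
       "(LINT x|\<mu>. ln (IRN d \<nu> x)) = (LINT x|\<mu>. ln (L x))"
    using IRN_eq[OF \<mu>] IRN_eq[OF \<nu>]
    by (auto intro!: Bochner_Integration.integral_cong simp: space_borel_probability[OF \<mu>(1)])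
  moreover have "integrable \<mu> (\<lambda>x. ln (K x))" "integrable \<mu> (\<lambda>x. ln (L x))"
    using \<mu> \<nu> by (auto intro!: integrable_continuous_Omega[of d] continuous_Omega_ln simp: is_IRN_def)
  ultimately show ?thesis by (simp add: D_KL_def)
qed

theorem theorem23:
  fixes d :: nat
    and J J\<^sub>1 J\<^sub>2 :: "(nat \<Rightarrow> nat) \<Rightarrow> real"
    and \<mu>\<^sub>1 \<mu>\<^sub>2 :: "(nat \<Rightarrow> nat) measure"
  assumes "d \<ge> 2"
    and "Jacobian d J" and "Holder_Omega d J"
    and "suitable d \<mu>\<^sub>1" and "is_IRN d \<mu>\<^sub>1 J\<^sub>1"
    and "suitable d \<mu>\<^sub>2" and "is_IRN d \<mu>\<^sub>2 J\<^sub>2"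
  shows "D_KL d \<mu>\<^sub>1 \<mu>\<^sub>2 - D_KL d (ruelle_dual d J \<mu>\<^sub>1) (ruelle_dual d J \<mu>\<^sub>2) = 0"
proof -
  let ?L = "\<lambda>K x. K (shift x) * J x * inverse (J (shift x)) :: real"
  let ?\<nu>\<^sub>1 = "ruelle_dual d J \<mu>\<^sub>1" and ?\<nu>\<^sub>2 = "ruelle_dual d J \<mu>\<^sub>2"
  have \<mu>: "borel_probability d \<mu>\<^sub>1" "borel_probability d \<mu>\<^sub>2"
    using assms(4,6) by (simp_all add: suitable_def)
  note \<nu> = ruelle_dual_eq_density(1)[OF \<mu>(1) assms(5,2)]
    ruelle_dual_eq_density(1)[OF \<mu>(2) assms(7,2)]
  have "D_KL d ?\<nu>\<^sub>1 ?\<nu>\<^sub>2 = (LINT x|?\<nu>\<^sub>1. ln (?L J\<^sub>1 x) - ln (?L J\<^sub>2 x))"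
    by (rule D_KL_eq[OF \<nu>(1) is_IRN_ruelle_dual[OF \<mu>(1) assms(5,2)]
          \<nu>(2) is_IRN_ruelle_dual[OF \<mu>(2) assms(7,2)]])
  also have "\<dots> = (LINT x|?\<nu>\<^sub>1. ln (J\<^sub>1 (shift x)) - ln (J\<^sub>2 (shift x)))"
  proof (intro Bochner_Integration.integral_cong refl)
    fix x assume "x \<in> space ?\<nu>\<^sub>1"
    then have x: "x \<in> Omega d" "shift x \<in> Omega d"
      by (simp_all add: space_borel_probability[OF \<nu>(1)] shift_in_Omega)
    then have "0 < J x" "0 < J (shift x)" "0 < J\<^sub>1 (shift x)" "0 < J\<^sub>2 (shift x)"
      using Jacobian_pos[OF assms(2)] assms(5,7) by (simp_all add: is_IRN_def)
    then show "ln (?L J\<^sub>1 x) - ln (?L J\<^sub>2 x) = ln (J\<^sub>1 (shift x)) - ln (J\<^sub>2 (shift x))"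
      by (simp add: ln_mult ln_inverse)
  qed
  also have "\<dots> = (LINT x|\<mu>\<^sub>1. ln (J\<^sub>1 x) - ln (J\<^sub>2 x))"
  proof (rule integral_ruelle_dual_shift[OF \<mu>(1) assms(5,2)])
    show "continuous_Omega d (\<lambda>x. ln (J\<^sub>1 x) - ln (J\<^sub>2 x))"
      using continuous_Omega_ln[of d J\<^sub>1] continuous_Omega_ln[of d J\<^sub>2] assms(5,7)
      by (simp add: is_IRN_def continuous_Omega_def continuous_map_diff)
  qed
  also have "\<dots> = D_KL d \<mu>\<^sub>1 \<mu>\<^sub>2"
    by (rule D_KL_eq[OF \<mu>(1) assms(5) \<mu>(2) assms(7), symmetric])
  finally show ?thesis by simp
qed

end
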